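(* Let $h:\mathbb{R}^n\to\mathbb{R}\cup\{+\infty\}$ be a proper function, let $S\subseteq\operatorname{dom}(h)$ be a convex set, and let $\nu\in(0,1]$. The following assertions are equivalent: (a) There exists a constant $C>0$ such that for all $x,y\in S$ and $\lambda\in[0,1]$, $$h(\lambda x+(1-\lambda)y)\le \lambda h(x)+(1-\lambda)h(y)+C\lambda(1-\lambda)\|x-y\|^{1+\nu}.$$ (b) The function $h$ is $\nu$-paraconvex on $S$. (c) There exists a constant $C>0$ such that for all $x,y\in S$ and $\lambda\in[0,1]$, $$h(\lambda x+(1-\lambda)y)\le \lambda h(x)+(1-\lambda)h(y)+C\|x-y\|^{1+\nu}.$$
   Context: $\|\cdot\|$ is the Euclidean norm and $\operatorname{dom}(h)=\{x:h(x)<+\infty\}$; $h$ is proper if $\operatorname{dom}(h)\neq\emptyset$. For $0<\nu\le 1$, a proper function $h$ is called $\nu$-paraconvex on a convex set $S\subseteq\operatorname{dom}(h)$ if there exists $\rho>0$ (called the constant) such that for all $x,y\in S$ and $\lambda\in[0,1]$, $$h(\lambda x+(1-\lambda)y)\le\lambda h(x)+(1-\lambda)h(y)+\rho\min\{\lambda,1-\lambda\}\|x-y\|^{1+\nu}.$$ *)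

theory Defs
  imports "HOL-Analysis.Analysis"
begin

text \<open>Functions with values in \<open>\<real> \<union> {+\<infinity>}\<close> are rendered as \<^typ>\<open>ereal\<close>-valued
  functions that never take the value \<open>-\<infinity>\<close>.\<close>

definition eff_dom :: "('a \<Rightarrow> ereal) \<Rightarrow> 'a set" where
  "eff_dom h = {x. h x < \<infinity>}"

text \<open>The first conjunct expresses the codomain \<open>\<real> \<union> {+\<infinity>}\<close>, the second one properness.\<close>

definition proper_fun :: "('a \<Rightarrow> ereal) \<Rightarrow> bool" where
  "proper_fun h \<longleftrightarrow> (\<forall>x. h x \<noteq> -\<infinity>) \<and> eff_dom h \<noteq> {}"

definition paraconvex_on :: "real \<Rightarrow> (real ^ 'n) set \<Rightarrow> (real ^ 'n \<Rightarrow> ereal) \<Rightarrow> bool" where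
  "paraconvex_on \<nu> S h \<longleftrightarrow>
     0 < \<nu> \<and> \<nu> \<le> 1 \<and> proper_fun h \<and> convex S \<and> S \<subseteq> eff_dom h \<and>
     (\<exists>\<rho>>0. \<forall>x\<in>S. \<forall>y\<in>S. \<forall>t\<in>{0..1}.
        h (t *\<^sub>R x + (1 - t) *\<^sub>R y)
          \<le> ereal t * h x + ereal (1 - t) * h y
             + ereal (\<rho> * min t (1 - t) * norm (x - y) powr (1 + \<nu>)))"

end

theory Submission
  imports Defs
begin

text \<open>
  Since \<open>t (1 - t) \<le> min t (1 - t) \<le> 2 t (1 - t)\<close> and \<open>min t (1 - t) \<le> 1\<close> on \<open>[0,1]\<close>, only the
  implication (c) to (b) has content: an error that does not decay as \<open>t \<rightarrow> 0\<close> must be improved to one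
  of order \<open>t\<close>. The reason this works is that (c) may be applied to pairs of points that are closer
  together than \<open>x\<close> and \<open>y\<close>. Let \<open>\<phi> t\<close> be the height of \<open>h\<close> over its chord from \<open>y\<close> (at \<open>t = 0\<close>) to
  \<open>x\<close> (at \<open>t = 1\<close>). The point with parameter \<open>t\<close> is the midpoint of \<open>y\<close> and the point with parameter
  \<open>2t\<close>, so (c) gives
  \<open>\<phi> t \<le> \<phi> (2t) / 2 + C (2t)\<^sup>p \<parallel>x - y\<parallel>\<^sup>p\<close> with \<open>p = 1 + \<nu>\<close>.
  Doubling \<open>t\<close> until it reaches \<open>[1/2, 1]\<close>, the errors add up to a geometric series of ratio
  \<open>2 powr \<nu> > 1\<close>, dominated by its last term, which is of order \<open>t\<close>. Hence
  \<open>\<phi> t = O(t \<parallel>x - y\<parallel>\<^sup>p)\<close>, and exchanging \<open>x\<close> and \<open>y\<close> replaces \<open>t\<close> by \<open>min t (1 - t)\<close>.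
  The lemma \<open>halving_recursion_bound\<close> carries the summation and \<open>approx_convex_imp_paraconvex\<close>
  the application to \<open>h\<close>, which takes only finite values on \<open>S\<close>.
\<close>

text \<open>
  Subtracting a multiple of \<open>t powr (1 + \<nu>)\<close> makes the claim stable under the recursion: \<open>L\<close> is the
  solution of \<open>L (2 powr \<nu> - 1) = 2 powr (1 + \<nu>)\<close>, for which the error of one halving step is absorbed
  exactly, and the linear coefficient then is what the range \<open>[1/2, 1]\<close> requires.
\<close>

lemma halving_recursion_bound:
  fixes \<phi> :: "real \<Rightarrow> real" and c \<nu> t :: real
  defines "L \<equiv> 2 powr (1 + \<nu>) / (2 powr \<nu> - 1)"
  assumes "0 < \<nu>" and "0 \<le> c"
    and halving: "\<And>t. 0 < t \<Longrightarrow> t \<le> 1/2 \<Longrightarrow> \<phi> t \<le> \<phi> (2 * t) / 2 + c * (2 * t) powr (1 + \<nu>)"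
    and top: "\<And>t. 1/2 \<le> t \<Longrightarrow> t \<le> 1 \<Longrightarrow> \<phi> t \<le> c"
    and "0 < t" and "t \<le> 1"
  shows "\<phi> t \<le> c * (2 * (1 + L) * t - L * t powr (1 + \<nu>))"
proof -
  have pos: "2 powr \<nu> > (1::real)"
    using \<open>0 < \<nu>\<close> by simp
  then have "L \<ge> 0"
    by (simp add: L_def)
  have L_eq: "L * 2 powr (1 + \<nu>) / 2 = L + 2 powr (1 + \<nu>)"
  proof -
    have "L * (2 powr \<nu> - 1) = 2 powr (1 + \<nu>)"
      using \<open>0 < \<nu>\<close> by (simp add: L_def)
    then show ?thesis
      by (simp add: powr_add algebra_simps)
  qed
  have step: "\<phi> t \<le> c * (2 * (1 + L) * t - L * t powr (1 + \<nu>))"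
    if "(1/2) ^ Suc k \<le> t" "t \<le> 1" for k t
    using that
  proof (induction k arbitrary: t)
    case 0
    then have "t powr (1 + \<nu>) \<le> 1"
      using \<open>0 < \<nu>\<close> by (simp add: powr_le1)
    then have "L * t powr (1 + \<nu>) \<le> L"
      using \<open>L \<ge> 0\<close> mult_left_le by blast
    moreover have "2 * (1 + L) * (1/2) \<le> 2 * (1 + L) * t"
      using 0 \<open>L \<ge> 0\<close> by (intro mult_left_mono) auto
    ultimately have "1 \<le> 2 * (1 + L) * t - L * t powr (1 + \<nu>)"
      by simp
    then have "c * 1 \<le> c * (2 * (1 + L) * t - L * t powr (1 + \<nu>))"
      using \<open>0 \<le> c\<close> by (rule mult_left_mono)
    with top[of t] 0 show ?case
      by simp
  next
    case (Suc k)
    show ?case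
    proof (cases "1/2 \<le> t")
      case True
      have "(1/2::real) ^ Suc k \<le> 1/2"
        by (simp add: power_le_one)
      with True Suc show ?thesis
        by force
    next
      case False
      have "(0::real) < (1/2) ^ Suc (Suc k)"
        by simp
      with Suc.prems have "0 < t"
        by linarith
      have "\<phi> (2 * t) \<le> c * (2 * (1 + L) * (2 * t) - L * (2 * t) powr (1 + \<nu>))"
        using Suc.prems False by (intro Suc.IH) auto
      with halving[of t] \<open>0 < t\<close> False
      have "\<phi> t \<le> c * (2 * (1 + L) * (2 * t) - L * (2 * t) powr (1 + \<nu>)) / 2
          + c * (2 * t) powr (1 + \<nu>)"
        by simp
      also have "\<dots> = c * (2 * (1 + L) * t
          - (L * 2 powr (1 + \<nu>) / 2 - 2 powr (1 + \<nu>)) * t powr (1 + \<nu>))"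
        using \<open>0 < t\<close> by (simp add: powr_mult field_simps)
      also have "\<dots> = c * (2 * (1 + L) * t - L * t powr (1 + \<nu>))"
        unfolding L_eq by simp
      finally show ?thesis .
    qed
  qed
  obtain k where "(1/2) ^ k < t"
    using real_arch_pow_inv[of t "1/2"] \<open>0 < t\<close> by auto
  moreover have "(1/2::real) ^ Suc k \<le> (1/2) ^ k"
    by simp
  ultimately show ?thesis
    using step[of k t] \<open>t \<le> 1\<close> by linarith
qed

lemma approx_convex_imp_paraconvex:
  fixes g :: "'a::real_normed_vector \<Rightarrow> real" and C \<nu> :: real
  assumes "convex S" and "0 < \<nu>" and "0 < C"
    and approx: "\<forall>x\<in>S. \<forall>y\<in>S. \<forall>t\<in>{0..1}.
      g (t *\<^sub>R x + (1 - t) *\<^sub>R y)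
        \<le> t * g x + (1 - t) * g y + C * norm (x - y) powr (1 + \<nu>)"
  shows "\<exists>\<rho>>0. \<forall>x\<in>S. \<forall>y\<in>S. \<forall>t\<in>{0..1}.
      g (t *\<^sub>R x + (1 - t) *\<^sub>R y)
        \<le> t * g x + (1 - t) * g y + \<rho> * min t (1 - t) * norm (x - y) powr (1 + \<nu>)"
proof -
  define L :: real where "L = 2 powr (1 + \<nu>) / (2 powr \<nu> - 1)"
  have "L \<ge> 0"
    using \<open>0 < \<nu>\<close> by (simp add: L_def ge_one_powr_ge_zero)
  define \<rho> where "\<rho> = C * (2 * (1 + L))"
  have linear: "g (t *\<^sub>R x + (1 - t) *\<^sub>R y)
      \<le> t * g x + (1 - t) * g y + \<rho> * t * norm (x - y) powr (1 + \<nu>)"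
    if "x \<in> S" "y \<in> S" "0 \<le> t" "t \<le> 1" for x y t
  proof (cases "t = 0")
    case False
    define z where "z s = s *\<^sub>R x + (1 - s) *\<^sub>R y" for s
    define \<phi> where "\<phi> s = g (z s) - s * g x - (1 - s) * g y" for s
    define c where "c = C * norm (x - y) powr (1 + \<nu>)"
    have "0 \<le> c"
      using \<open>0 < C\<close> by (simp add: c_def)
    have "\<phi> t \<le> c * (2 * (1 + L) * t - L * t powr (1 + \<nu>))"
      unfolding L_def
    proof (rule halving_recursion_bound[OF \<open>0 < \<nu>\<close> \<open>0 \<le> c\<close>])
      fix s :: real
      assume s: "0 < s" "s \<le> 1/2"
      have "z (2 * s) \<in> S"
        unfolding z_def using \<open>convex S\<close> that s by (intro convexD) auto
      then have "g ((1/2) *\<^sub>R z (2 * s) + (1 - 1/2) *\<^sub>R y)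
          \<le> (1/2) * g (z (2 * s)) + (1 - 1/2) * g y + C * norm (z (2 * s) - y) powr (1 + \<nu>)"
        using \<open>y \<in> S\<close> by (intro approx[rule_format]) auto
      moreover have "(1/2) *\<^sub>R z (2 * s) + (1 - 1/2) *\<^sub>R y = z s"
        by (simp add: z_def algebra_simps flip: scaleR_add_left)
      moreover have "z (2 * s) - y = (2 * s) *\<^sub>R (x - y)"
        by (simp add: z_def algebra_simps)
      then have "norm (z (2 * s) - y) powr (1 + \<nu>)
          = (2 * s) powr (1 + \<nu>) * norm (x - y) powr (1 + \<nu>)"
        using s by (simp add: powr_mult)
      ultimately show "\<phi> s \<le> \<phi> (2 * s) / 2 + c * (2 * s) powr (1 + \<nu>)"
        by (simp add: \<phi>_def c_def field_simps)
    next
      fix s :: real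
      assume "1/2 \<le> s" "s \<le> 1"
      then show "\<phi> s \<le> c"
        using approx[rule_format, OF \<open>x \<in> S\<close> \<open>y \<in> S\<close>, of s]
        by (simp add: \<phi>_def c_def z_def)
    qed (use False that in auto)
    also have "\<dots> \<le> c * (2 * (1 + L) * t)"
      using \<open>0 \<le> c\<close> \<open>L \<ge> 0\<close> by (intro mult_left_mono) auto
    finally show ?thesis
      by (simp add: \<phi>_def z_def c_def \<rho>_def algebra_simps)
  qed auto
  have "g (t *\<^sub>R x + (1 - t) *\<^sub>R y)
      \<le> t * g x + (1 - t) * g y + \<rho> * min t (1 - t) * norm (x - y) powr (1 + \<nu>)"
    if "x \<in> S" "y \<in> S" "t \<in> {0..1}" for x y t
    using linear[of x y t] linear[of y x "1 - t"] that
    by (simp add: min_def add.commute norm_minus_commute)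
  moreover have "\<rho> > 0"
    using \<open>0 < C\<close> \<open>L \<ge> 0\<close> by (simp add: \<rho>_def)
  ultimately show ?thesis
    by blast
qed

lemma proper_fun_chord_ineq_real:
  fixes h :: "'a::real_vector \<Rightarrow> ereal"
  assumes "proper_fun h" "S \<subseteq> eff_dom h" "convex S" "x \<in> S" "y \<in> S" "t \<in> {0..1}"
  shows "h (t *\<^sub>R x + (1 - t) *\<^sub>R y) \<le> ereal t * h x + ereal (1 - t) * h y + ereal e
    \<longleftrightarrow> real_of_ereal (h (t *\<^sub>R x + (1 - t) *\<^sub>R y))
      \<le> t * real_of_ereal (h x) + (1 - t) * real_of_ereal (h y) + e"
proof -
  have fin: "h z = ereal (real_of_ereal (h z))" if "z \<in> S" for z
    using assms(1,2) that by (cases "h z") (auto simp: proper_fun_def eff_dom_def)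
  have "t *\<^sub>R x + (1 - t) *\<^sub>R y \<in> S"
    using assms by (intro convexD) auto
  from fin[OF this] fin[OF \<open>x \<in> S\<close>] fin[OF \<open>y \<in> S\<close>] show ?thesis
    by (metis ereal_less_eq(3) plus_ereal.simps(1) times_ereal.simps(1))
qed

theorem proposition3p2:
  fixes h :: "real ^ 'n \<Rightarrow> ereal" and S :: "(real ^ 'n) set" and \<nu> :: real
  assumes "proper_fun h"
    and "S \<subseteq> eff_dom h" and "convex S"
    and "0 < \<nu>" and "\<nu> \<le> 1"
  shows "((\<exists>C::real. C > 0 \<and> (\<forall>x\<in>S. \<forall>y\<in>S. \<forall>t\<in>{0..1}.
            h (t *\<^sub>R x + (1 - t) *\<^sub>R y)
              \<le> ereal t * h x + ereal (1 - t) * h y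
                 + ereal (C * t * (1 - t) * norm (x - y) powr (1 + \<nu>))))
          \<longleftrightarrow> paraconvex_on \<nu> S h)
       \<and> (paraconvex_on \<nu> S h \<longleftrightarrow>
          (\<exists>C::real. C > 0 \<and> (\<forall>x\<in>S. \<forall>y\<in>S. \<forall>t\<in>{0..1}.
            h (t *\<^sub>R x + (1 - t) *\<^sub>R y)
              \<le> ereal t * h x + ereal (1 - t) * h y
                 + ereal (C * norm (x - y) powr (1 + \<nu>)))))"
proof -
  define g where "g x = real_of_ereal (h x)" for x
  define E where "E e \<longleftrightarrow> (\<forall>x\<in>S. \<forall>y\<in>S. \<forall>t\<in>{0..1}.
      g (t *\<^sub>R x + (1 - t) *\<^sub>R y)
        \<le> t * g x + (1 - t) * g y + e t * norm (x - y) powr (1 + \<nu>))" for e :: "real \<Rightarrow> real"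
  have E_ereal: "(\<forall>x\<in>S. \<forall>y\<in>S. \<forall>t\<in>{0..1}. h (t *\<^sub>R x + (1 - t) *\<^sub>R y)
      \<le> ereal t * h x + ereal (1 - t) * h y + ereal (e t * norm (x - y) powr (1 + \<nu>))) \<longleftrightarrow> E e" for e
    unfolding E_def g_def using proper_fun_chord_ineq_real[OF assms(1-3)]
    by (intro ball_cong refl) blast
  have E_mono: "E e'" if "E e" "\<And>t. t \<in> {0..1} \<Longrightarrow> e t \<le> e' t" for e e'
    using that unfolding E_def by (meson add_left_mono mult_right_mono order_trans powr_ge_zero)
  have b: "paraconvex_on \<nu> S h \<longleftrightarrow> (\<exists>\<rho>>0. E (\<lambda>t. \<rho> * min t (1 - t)))"
    unfolding paraconvex_on_def using assms by (simp add: E_ereal)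
  have a_imp_b: "E (\<lambda>t. C * min t (1 - t))" if "E (\<lambda>t. C * t * (1 - t))" "C > 0" for C
  proof (rule E_mono[OF that(1)])
    fix t :: real
    assume "t \<in> {0..1}"
    then have "t * (1 - t) \<le> min t (1 - t)"
      by (simp add: mult_left_le mult_left_le_one_le)
    with \<open>C > 0\<close> show "C * t * (1 - t) \<le> C * min t (1 - t)"
      by (simp add: mult.assoc)
  qed
  have b_imp_a: "E (\<lambda>t. 2 * C * t * (1 - t))" if "E (\<lambda>t. C * min t (1 - t))" "C > 0" for C
  proof (rule E_mono[OF that(1)])
    fix t :: real
    assume t: "t \<in> {0..1}"
    \<comment> \<open>The product is the minimum times the maximum, and the latter is at least \<open>1/2\<close>.\<close>
    have "min t (1 - t) * 1 \<le> min t (1 - t) * (2 * max t (1 - t))"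
      using t by (intro mult_left_mono) (auto simp: max_def)
    also have "\<dots> = 2 * t * (1 - t)"
      by (simp add: min_def max_def)
    finally show "C * min t (1 - t) \<le> 2 * C * t * (1 - t)"
      using \<open>C > 0\<close> by (simp add: mult.assoc mult.left_commute)
  qed
  have b_imp_c: "E (\<lambda>t. C)" if "E (\<lambda>t. C * min t (1 - t))" "C > 0" for C
    by (rule E_mono[OF that(1)]) (use \<open>C > 0\<close> in auto)
  have c_imp_b: "\<exists>\<rho>>0. E (\<lambda>t. \<rho> * min t (1 - t))" if "E (\<lambda>t. C)" "C > 0" for C
    using approx_convex_imp_paraconvex[OF \<open>convex S\<close> \<open>0 < \<nu>\<close> \<open>C > 0\<close>] that(1)
    unfolding E_def by blast
  have "(\<exists>C>0. E (\<lambda>t. C * t * (1 - t))) \<longleftrightarrow> paraconvex_on \<nu> S h"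
    unfolding b using a_imp_b b_imp_a by (metis mult_pos_pos zero_less_numeral)
  moreover have "paraconvex_on \<nu> S h \<longleftrightarrow> (\<exists>C>0. E (\<lambda>t. C))"
    unfolding b using b_imp_c c_imp_b by blast
  ultimately show ?thesis
    unfolding E_ereal by blast
qed

end
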